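(* Let $M\in\mathbb{N}$, $M\ge 1$, be fixed. The numerical flow $\Phi_h^{[M]}$ of the $p$-implicit Symplectic Euler method with $M$ fixed point iterations for the Hamiltonian $H$ satisfies $$(D\Phi_h^{[M]})^TJ(D\Phi_h^{[M]})=\begin{pmatrix}D&I+E\\-(I+E)^T&O\end{pmatrix}=J+\begin{pmatrix}D&E\\-E^T&O\end{pmatrix},$$ where both $N\times N$ matrices $D$ and $E$ (depending on $h$ and $(q,p)$) are of order $\mathcal{O}(h^{M+1})$ as $h\to 0$.
   Context: Let $N\ge 1$, let $\mathcal{D}\subset\mathbb{R}^N\times\mathbb{R}^N$ be compact and convex, and let $H=H(q,p)$ be a real-valued Hamiltonian which is sufficiently smooth on $\mathcal{D}$ (all derivatives exist and are continuous; concretely, $H$ is $C^\infty$ on an open neighbourhood of $\mathcal{D}$). $H_q,H_p$ denote the gradients of $H$ with respect to $q$ and $p$. $J=\begin{pmatrix}O&I\\-I&O\end{pmatrix}\in\mathbb{R}^{2N\times 2N}$, with $I$ the $N\times N$ identity and $O$ the zero matrix. The $p$-implicit Symplectic Euler method with $M$ fixed point iterations and step $h>0$: given $(q,p)$, put $p_0:=p$, $p_{n+1}:=p-hH_q(q,p_n)$ for $n=0,\dots,M-1$, $\tilde p:=p_M$, $\tilde q:=q+hH_p(q,\tilde p)$; the numerical flow is $\Phi_h^{[M]}(q,p):=(\tilde q,\tilde p)$, and $D\Phi_h^{[M]}$ is its $2N\times 2N$ Jacobian matrix with respect to $(q,p)$. Standing assumption: $S\subset\mathcal{D}$ is a set of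 initial values and $h_0>0$ is such that for all $0<h\le h_0$ and $(q,p)\in S$ all points at which $H$ and its derivatives are evaluated in the scheme, and the result of the step, lie in $\mathcal{D}$. A matrix depending on $h$ and $(q,p)$ is $\mathcal{O}(h^r)$ if its norm is at most $Ch^r$ for all sufficiently small $h\in(0,h_0]$ and all $(q,p)\in S$, with $C$ independent of $h$ and $(q,p)$ (it may depend on $H,\mathcal{D},M,N$). *)

theory Defs
  imports "HOL-Analysis.Analysis"
begin

(* Iterated directional Frechet derivatives exist and are continuous. Intended for open S:
   since "at x" is the full neighbourhood filter, f is then C^k on S in the usual sense
   (all partial derivatives up to order k) when the domain is finite-dimensional. *)
primrec C_k_on ::
  "nat \<Rightarrow> ('a::real_normed_vector \<Rightarrow> 'b::real_normed_vector) \<Rightarrow> 'a set \<Rightarrow> bool"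
where
  "C_k_on 0 f S \<longleftrightarrow> continuous_on S f"
| "C_k_on (Suc k) f S \<longleftrightarrow>
     (\<forall>x\<in>S. f differentiable at x) \<and>
     (\<forall>v. C_k_on k (\<lambda>x. frechet_derivative f (at x) v) S)"

definition smooth_on :: "('a::real_normed_vector \<Rightarrow> 'b::real_normed_vector) \<Rightarrow> 'a set \<Rightarrow> bool"
  where "smooth_on f S \<longleftrightarrow> (\<forall>k. C_k_on k f S)"

(* Unspecified where f is not differentiable. *)
definition grad :: "('a::real_inner \<Rightarrow> real) \<Rightarrow> 'a \<Rightarrow> 'a"
  where "grad f x = (THE d. GDERIV f x :> d)"

definition grad_q :: "('a::real_inner \<times> 'b::real_inner \<Rightarrow> real) \<Rightarrow> 'a \<Rightarrow> 'b \<Rightarrow> 'a"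
  where "grad_q H q p = grad (\<lambda>q'. H (q', p)) q"

definition grad_p :: "('a::real_inner \<times> 'b::real_inner \<Rightarrow> real) \<Rightarrow> 'a \<Rightarrow> 'b \<Rightarrow> 'b"
  where "grad_p H q p = grad (\<lambda>p'. H (q, p')) p"

primrec p_iter ::
  "((real^'n) \<times> (real^'n) \<Rightarrow> real) \<Rightarrow> real \<Rightarrow> real^'n \<Rightarrow> real^'n \<Rightarrow> nat \<Rightarrow> real^'n"
where
  "p_iter H h q p 0 = p"
| "p_iter H h q p (Suc n) = p - h *\<^sub>R grad_q H q (p_iter H h q p n)"

definition sympl_euler ::
  "((real^'n) \<times> (real^'n) \<Rightarrow> real) \<Rightarrow> nat \<Rightarrow> real \<Rightarrow> (real^'n) \<times> (real^'n) \<Rightarrow> (real^'n) \<times> (real^'n)"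
where
  "sympl_euler H M h =
     (\<lambda>(q, p). let p' = p_iter H h q p M in (q + h *\<^sub>R grad_p H q p', p'))"

(* The derivatives of H are evaluated at (q, p_n) for n < M and at (q, p_M). *)
definition admissible ::
  "((real^'n) \<times> (real^'n) \<Rightarrow> real) \<Rightarrow> ((real^'n) \<times> (real^'n)) set \<Rightarrow> nat \<Rightarrow> ((real^'n) \<times> (real^'n)) set \<Rightarrow> real \<Rightarrow> bool"
where
  "admissible H \<D> M S h0 \<longleftrightarrow>
     S \<subseteq> \<D> \<and> 0 < h0 \<and>
     (\<forall>h q p. 0 < h \<and> h \<le> h0 \<and> (q, p) \<in> S \<longrightarrow>
        (\<forall>n\<le>M. (q, p_iter H h q p n) \<in> \<D>) \<and> sympl_euler H M h (q, p) \<in> \<D>)"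

(* Pairs (q, p) identified with column vectors of length 2N: Inl indexes q, Inr indexes p. *)
definition stack :: "(real^'n) \<times> (real^'n) \<Rightarrow> real^('n + 'n)"
  where "stack z = (\<chi> i. case i of Inl a \<Rightarrow> fst z $ a | Inr b \<Rightarrow> snd z $ b)"

definition unstack :: "real^('n + 'n) \<Rightarrow> (real^'n) \<times> (real^'n)"
  where "unstack x = ((\<chi> a. x $ Inl a), (\<chi> b. x $ Inr b))"

definition stacked ::
  "((real^'n) \<times> (real^'n) \<Rightarrow> (real^'n) \<times> (real^'n)) \<Rightarrow> real^('n + 'n) \<Rightarrow> real^('n + 'n)"
  where "stacked f = stack \<circ> f \<circ> unstack"

definition block_matrix ::
  "real^'n^'n \<Rightarrow> real^'n^'n \<Rightarrow> real^'n^'n \<Rightarrow> real^'n^'n \<Rightarrow> real^('n + 'n)^('n + 'n)"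
where
  "block_matrix A B C D = (\<chi> i j.
     case i of
       Inl a \<Rightarrow> (case j of Inl b \<Rightarrow> A $ a $ b | Inr b \<Rightarrow> B $ a $ b)
     | Inr a \<Rightarrow> (case j of Inl b \<Rightarrow> C $ a $ b | Inr b \<Rightarrow> D $ a $ b))"

definition sympl_J :: "real^('n::finite + 'n)^('n + 'n)"
  where "sympl_J = block_matrix 0 (mat 1) (- mat 1) 0"

(* A h z = O(h^r) as h -> 0, uniformly in z : S, with the constant C made explicit. *)
definition order_with_const ::
  "real \<Rightarrow> nat \<Rightarrow> real \<Rightarrow> ((real^'n) \<times> (real^'n)) set \<Rightarrow>
     (real \<Rightarrow> (real^'n) \<times> (real^'n) \<Rightarrow> real^'n^'n) \<Rightarrow> bool"
where
  "order_with_const C r h0 S A \<longleftrightarrow>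
     (\<forall>\<^sub>F h in at_right 0. h \<le> h0 \<longrightarrow> (\<forall>z\<in>S. norm (A h z) \<le> C * h ^ r))"

end

theory Submission
  imports Defs
begin

text \<open>
  Let \<open>p\<^sub>n\<close> be the fixed point iterates, \<open>p\<^sub>0 = p\<close>, and let \<open>r = p\<^sub>M - p\<^sub>M\<^sub>+\<^sub>1\<close> be the residual
  left when the iteration is stopped after \<open>M\<close> steps. Since \<open>p\<^sub>M + h H\<^sub>q(q, p\<^sub>M) = p + r\<close>, the
  computed step \<open>(q, p) \<mapsto> (q', p')\<close>, where \<open>p' = p\<^sub>M\<close>, solves the implicit symplectic Euler equations exactly, but
  for the initial value \<open>(q, p + r)\<close>. That implicit method is symplectic, so pulling the form
  \<open>dq \<and> dp\<close> back along the step gives \<open>dq \<and> d(p + r) = dq \<and> dp + dq \<and> dr\<close>. Hence the defect is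
  read off from the derivative of \<open>r\<close> alone: \<open>E = r\<^sub>p\<close> and \<open>D = r\<^sub>q - r\<^sub>q\<^sup>T\<close>, with a zero block in
  the lower right corner. The lemma \<open>sympl_form_pullback\<close> carries out this computation on
  tangent vectors; its only input is the symmetry of the Hessian of \<open>H\<close>, which is derived from
  \<open>symmetric_second_derivative\<close>.
  
  It remains to see that \<open>dr\<close> is of order \<open>h\<^sup>M\<^sup>+\<^sup>1\<close>. On the compact convex set the gradient and
  the Hessian of \<open>H\<close> are bounded and Lipschitz with a common constant \<open>K\<close>. The iteration map has
  Lipschitz constant \<open>h K\<close>, so \<open>p\<^sub>n\<^sub>+\<^sub>1 - p\<^sub>n\<close> is at most \<open>(h K)\<^sup>n\<^sup>+\<^sup>1\<close>. Differentiating the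
  recursion and using the Lipschitz bound of the Hessian shows by induction that the derivatives
  of consecutive iterates differ by at most \<open>3 (n + 1) (h K)\<^sup>n\<^sup>+\<^sup>1\<close> once \<open>h K \<le> 1/3\<close>
  (\<open>norm_p_iter_deriv_diff_le\<close>).
  The case \<open>n = M\<close> is the claim, and the constant depends only on \<open>K\<close>, \<open>M\<close> and \<open>N\<close>.
\<close>


section \<open>Symmetry of the second derivative\<close>

text \<open>
  The second difference of \<open>f\<close> over a parallelogram is a first difference, in direction \<open>u\<close>, of
  the function \<open>y \<mapsto> f (y + s v) - f y\<close>. The mean value theorem turns it into \<open>s\<close> times a first
  difference, in direction \<open>v\<close>, of the derivative along \<open>u\<close>; a second use of the mean value
  theorem produces the mixed derivative.
\<close>
lemma mixed_difference_mean_value: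
  fixes f :: "'a::real_normed_vector \<Rightarrow> real"
  assumes "s > 0"
    and S: "\<And>a b. a \<in> {0..s} \<Longrightarrow> b \<in> {0..s} \<Longrightarrow> x + a *\<^sub>R u + b *\<^sub>R v \<in> S"
    and f: "\<And>y. y \<in> S \<Longrightarrow> f differentiable at y"
    and fu: "\<And>y. y \<in> S \<Longrightarrow> (\<lambda>y. frechet_derivative f (at y) u) differentiable at y"
  shows "\<exists>a\<in>{0..s}. \<exists>b\<in>{0..s}.
    f (x + s *\<^sub>R u + s *\<^sub>R v) - f (x + s *\<^sub>R u) - f (x + s *\<^sub>R v) + f x
      = s * s * frechet_derivative (\<lambda>y. frechet_derivative f (at y) u)
                  (at (x + a *\<^sub>R u + b *\<^sub>R v)) v"
proof -
  define F where "F = (\<lambda>y. frechet_derivative f (at y) u)"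
  have along: "((\<lambda>t. g (c + t *\<^sub>R w)) has_real_derivative frechet_derivative g (at (c + t *\<^sub>R w)) w) (at t)"
    if g: "g differentiable at (c + t *\<^sub>R w)" for g :: "'a \<Rightarrow> real" and c w t
  proof -
    have l: "linear (frechet_derivative g (at (c + t *\<^sub>R w)))"
      using g linear_frechet_derivative by blast
    have "((\<lambda>t. c + t *\<^sub>R w) has_derivative (\<lambda>t. t *\<^sub>R w)) (at t)"
      by (auto intro!: derivative_eq_intros)
    from has_derivative_compose[OF this, of g] g
    have "((\<lambda>t. g (c + t *\<^sub>R w)) has_derivative
        (\<lambda>r. frechet_derivative g (at (c + t *\<^sub>R w)) (r *\<^sub>R w))) (at t)"
      by (simp add: frechet_derivative_works)
    then show ?thesis
      using linear_cmul[OF l] by (simp add: has_field_derivative_def mult_commute_abs)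
  qed
  have "\<exists>a. 0 < a \<and> a < s \<and>
      (f (x + s *\<^sub>R v + s *\<^sub>R u) - f (x + s *\<^sub>R u))
       - (f (x + s *\<^sub>R v + 0 *\<^sub>R u) - f (x + 0 *\<^sub>R u))
      = (s - 0) * (F (x + s *\<^sub>R v + a *\<^sub>R u) - F (x + a *\<^sub>R u))"
  proof (rule MVT2[OF \<open>0 < s\<close>])
    fix t assume t: "0 \<le> t" "t \<le> s"
    have "f differentiable at (x + s *\<^sub>R v + t *\<^sub>R u)"
      using f S[of t s] t \<open>0 < s\<close> by (simp add: ac_simps)
    moreover have "f differentiable at (x + t *\<^sub>R u)"
      using f S[of t 0] t \<open>0 < s\<close> by simp
    ultimately show "((\<lambda>t. f (x + s *\<^sub>R v + t *\<^sub>R u) - f (x + t *\<^sub>R u)) has_real_derivative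
        F (x + s *\<^sub>R v + t *\<^sub>R u) - F (x + t *\<^sub>R u)) (at t)"
      unfolding F_def by (intro DERIV_diff along)
  qed
  then obtain a where a: "0 < a" "a < s" and ea:
      "f (x + s *\<^sub>R u + s *\<^sub>R v) - f (x + s *\<^sub>R u) - f (x + s *\<^sub>R v) + f x
        = s * (F (x + a *\<^sub>R u + s *\<^sub>R v) - F (x + a *\<^sub>R u))"
    by (auto simp: ac_simps algebra_simps)
  have "\<exists>b. 0 < b \<and> b < s \<and> F (x + a *\<^sub>R u + s *\<^sub>R v) - F (x + a *\<^sub>R u + 0 *\<^sub>R v)
      = (s - 0) * frechet_derivative F (at (x + a *\<^sub>R u + b *\<^sub>R v)) v"
  proof (rule MVT2[OF \<open>0 < s\<close>])
    fix t assume t: "0 \<le> t" "t \<le> s"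
    have "F differentiable at (x + a *\<^sub>R u + t *\<^sub>R v)"
      unfolding F_def using fu S[of a t] t a by simp
    then show "((\<lambda>t. F (x + a *\<^sub>R u + t *\<^sub>R v)) has_real_derivative
        frechet_derivative F (at (x + a *\<^sub>R u + t *\<^sub>R v)) v) (at t)"
      by (rule along)
  qed
  then obtain b where b: "0 < b" "b < s" and eb:
      "F (x + a *\<^sub>R u + s *\<^sub>R v) - F (x + a *\<^sub>R u)
        = s * frechet_derivative F (at (x + a *\<^sub>R u + b *\<^sub>R v)) v"
    by auto
  have "a \<in> {0..s}" "b \<in> {0..s}" using a b by auto
  moreover have "f (x + s *\<^sub>R u + s *\<^sub>R v) - f (x + s *\<^sub>R u) - f (x + s *\<^sub>R v) + f x
      = s * s * frechet_derivative F (at (x + a *\<^sub>R u + b *\<^sub>R v)) v"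
    using ea eb by simp
  ultimately show ?thesis unfolding F_def by blast
qed

text \<open>
  The second difference does not change when \<open>u\<close> and \<open>v\<close> are exchanged. Divided by \<open>s\<^sup>2\<close> it is a
  value of either mixed derivative at a point near \<open>x\<close>, so by continuity both agree at \<open>x\<close>.
\<close>
lemma symmetric_second_derivative:
  fixes f :: "'a::real_normed_vector \<Rightarrow> real"
  assumes "open S" "x \<in> S" and C2: "C_k_on 2 f S"
  shows "frechet_derivative (\<lambda>y. frechet_derivative f (at y) u) (at x) v
       = frechet_derivative (\<lambda>y. frechet_derivative f (at y) v) (at x) u"
proof -
  define P where "P = (\<lambda>u v y. frechet_derivative (\<lambda>y. frechet_derivative f (at y) u) (at y) v)"
  have f: "f differentiable at y" if "y \<in> S" for y
    using C2 that by (simp add: numeral_2_eq_2)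
  have fu: "(\<lambda>y. frechet_derivative f (at y) u) differentiable at y" if "y \<in> S" for y u
    using C2 that by (simp add: numeral_2_eq_2)
  have P: "continuous_on S (P u v)" for u v
    using C2 by (simp add: numeral_2_eq_2 P_def)
  have close: "\<bar>P u v x - P v u x\<bar> \<le> e" if "e > 0" for e
  proof -
    have ev: "\<forall>\<^sub>F y in nhds x. y \<in> S \<and> dist (P u v y) (P u v x) < e/2 \<and> dist (P v u y) (P v u x) < e/2"
    proof (intro eventually_conj)
      show "\<forall>\<^sub>F y in nhds x. y \<in> S" using assms by (simp add: eventually_nhds_in_open)
      have "continuous (at x) (P u v)" for u v
        using P assms continuous_on_eq_continuous_at by blast
      then have "(P u v \<longlongrightarrow> P u v x) (nhds x)" for u v
        by (simp add: isCont_def tendsto_at_iff_tendsto_nhds)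
      then show "\<forall>\<^sub>F y in nhds x. dist (P u v y) (P u v x) < e/2"
        "\<forall>\<^sub>F y in nhds x. dist (P v u y) (P v u x) < e/2"
        using tendstoD[of _ _ _ "e/2"] half_gt_zero[OF that] by blast+
    qed
    then obtain d where "d > 0"
      and d: "\<And>y. dist y x < d \<Longrightarrow> y \<in> S \<and> \<bar>P u v y - P u v x\<bar> < e/2 \<and> \<bar>P v u y - P v u x\<bar> < e/2"
      unfolding eventually_nhds_metric dist_real_def by blast
    \<comment> \<open>small enough for the whole parallelogram to lie within distance \<open>d\<close> of \<open>x\<close>\<close>
    define s where "s = d / (2 * (norm u + norm v + 1))"
    have n: "norm u + norm v + 1 > 0" by (simp add: add_nonneg_pos)
    have "s > 0" using \<open>d > 0\<close> n by (simp add: s_def)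
    have near: "dist (x + a *\<^sub>R u + b *\<^sub>R v) x < d" if "a \<in> {0..s}" "b \<in> {0..s}" for a b
    proof -
      have "dist (x + a *\<^sub>R u + b *\<^sub>R v) x = norm (a *\<^sub>R u + b *\<^sub>R v)"
        by (simp add: dist_norm)
      also have "\<dots> \<le> a * norm u + b * norm v"
        using norm_triangle_ineq[of "a *\<^sub>R u" "b *\<^sub>R v"] that by simp
      also have "\<dots> \<le> s * norm u + s * norm v"
        using that by (intro add_mono mult_right_mono) auto
      also have "\<dots> \<le> s * (norm u + norm v + 1)" using \<open>s > 0\<close> by (simp add: algebra_simps)
      also have "\<dots> = d / 2" using n by (simp add: s_def field_simps)
      also have "\<dots> < d" using \<open>d > 0\<close> by simp
      finally show ?thesis .
    qed
    have near': "dist (x + a *\<^sub>R v + b *\<^sub>R u) x < d" if "a \<in> {0..s}" "b \<in> {0..s}" for a b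
      using near[OF that(2,1)] by (simp add: ac_simps)
    obtain a b where ab: "a \<in> {0..s}" "b \<in> {0..s}"
      "f (x + s *\<^sub>R u + s *\<^sub>R v) - f (x + s *\<^sub>R u) - f (x + s *\<^sub>R v) + f x
        = s * s * P u v (x + a *\<^sub>R u + b *\<^sub>R v)"
      using mixed_difference_mean_value[OF \<open>s > 0\<close>, of x u v S f] near d f fu unfolding P_def by blast
    obtain a' b' where ab': "a' \<in> {0..s}" "b' \<in> {0..s}"
      "f (x + s *\<^sub>R v + s *\<^sub>R u) - f (x + s *\<^sub>R v) - f (x + s *\<^sub>R u) + f x
        = s * s * P v u (x + a' *\<^sub>R v + b' *\<^sub>R u)"
      using mixed_difference_mean_value[OF \<open>s > 0\<close>, of x v u S f] near' d f fu unfolding P_def by blast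
    have "s * s * P u v (x + a *\<^sub>R u + b *\<^sub>R v) = s * s * P v u (x + a' *\<^sub>R v + b' *\<^sub>R u)"
      unfolding ab(3)[symmetric] ab'(3)[symmetric] by (simp add: ac_simps)
    then have "P u v (x + a *\<^sub>R u + b *\<^sub>R v) = P v u (x + a' *\<^sub>R v + b' *\<^sub>R u)"
      using \<open>s > 0\<close> by simp
    moreover have "\<bar>P u v (x + a *\<^sub>R u + b *\<^sub>R v) - P u v x\<bar> < e/2"
      using d near ab by blast
    moreover have "\<bar>P v u (x + a' *\<^sub>R v + b' *\<^sub>R u) - P v u x\<bar> < e/2"
      using d near' ab' by blast
    ultimately show ?thesis by linarith
  qed
  have "\<bar>P u v x - P v u x\<bar> \<le> 0"
    by (rule field_le_epsilon) (use close in auto)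
  then show ?thesis by (simp add: P_def)
qed

section \<open>Gradient and Hessian\<close>

definition hess :: "('a::real_inner \<Rightarrow> real) \<Rightarrow> 'a \<Rightarrow> 'a \<Rightarrow> 'a"
  where "hess H x = frechet_derivative (grad H) (at x)"

lemma grad_eqI:
  assumes "(H has_derivative (\<lambda>w. w \<bullet> d)) (at x)"
  shows "grad H x = d"
  unfolding grad_def gderiv_def
proof (rule the_equality)
  fix d' assume "(H has_derivative (\<lambda>w. w \<bullet> d')) (at x)"
  then have "(\<lambda>w. w \<bullet> d') = (\<lambda>w. w \<bullet> d)"
    using assms has_derivative_unique by blast
  then have "(d' - d) \<bullet> (d' - d) = 0"
    by (metis inner_diff_right right_minus_eq)
  then show "d' = d" by simp
qed (fact assms)

lemma grad_eq_sum_partials: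
  fixes H :: "'a::euclidean_space \<Rightarrow> real"
  assumes "H differentiable at x"
  shows "grad H x = (\<Sum>b\<in>Basis. frechet_derivative H (at x) b *\<^sub>R b)" (is "_ = ?d")
    and "(H has_derivative (\<lambda>w. w \<bullet> grad H x)) (at x)"
proof -
  have l: "linear (frechet_derivative H (at x))"
    using assms linear_frechet_derivative by blast
  have "frechet_derivative H (at x) w = w \<bullet> ?d" for w
  proof -
    have "frechet_derivative H (at x) (\<Sum>b\<in>Basis. (w \<bullet> b) *\<^sub>R b)
        = (\<Sum>b\<in>Basis. (w \<bullet> b) * frechet_derivative H (at x) b)"
      by (simp add: linear_sum[OF l] linear_cmul[OF l])
    then show ?thesis by (simp add: euclidean_representation inner_sum_right mult.commute)
  qed
  then have *: "(H has_derivative (\<lambda>w. w \<bullet> ?d)) (at x)"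
    using assms frechet_derivative_works by (metis (no_types, lifting) ext)
  then show "grad H x = ?d" by (rule grad_eqI)
  with * show "(H has_derivative (\<lambda>w. w \<bullet> grad H x)) (at x)" by simp
qed

text \<open>
  Working with the full gradient makes one Hessian carry all four blocks \<open>H\<^sub>q\<^sub>q\<close>, \<open>H\<^sub>q\<^sub>p\<close>, \<open>H\<^sub>p\<^sub>q\<close>,
  \<open>H\<^sub>p\<^sub>p\<close>, so that the relations between them become the single statement that it is
  self-adjoint.
\<close>
lemma partial_gradients:
  fixes H :: "'a::euclidean_space \<times> 'b::euclidean_space \<Rightarrow> real"
  assumes "H differentiable at (q, p)"
  shows "grad_q H q p = fst (grad H (q, p))" "grad_p H q p = snd (grad H (q, p))"
proof -
  note D = grad_eq_sum_partials(2)[OF assms]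
  have "((\<lambda>q'. (q', p)) has_derivative (\<lambda>w. (w, 0))) (at q)"
    by (auto intro!: derivative_eq_intros)
  from has_derivative_compose[OF this D]
  show "grad_q H q p = fst (grad H (q, p))"
    unfolding grad_q_def by (intro grad_eqI) (simp add: inner_prod_def)
  have "((\<lambda>p'. (q, p')) has_derivative (\<lambda>w. (0, w))) (at p)"
    by (auto intro!: derivative_eq_intros)
  from has_derivative_compose[OF this D]
  show "grad_p H q p = snd (grad H (q, p))"
    unfolding grad_p_def by (intro grad_eqI) (simp add: inner_prod_def)
qed

text \<open>
  Near \<open>x\<close> the gradient is the sum of the partial derivatives times the basis vectors, which can be
  differentiated term by term. Moving \<open>w'\<close> from the basis expansion into the innermost derivative
  needs linearity in the direction in which the derivative is taken last; symmetry of second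
  derivatives brings each term into that form, and back again.
\<close>
lemma hess_as_second_derivative:
  fixes H :: "'a::euclidean_space \<Rightarrow> real"
  assumes "open U" "x \<in> U" and C2: "C_k_on 2 H U"
  shows "(grad H has_derivative hess H x) (at x)"
    and "hess H x w \<bullet> w' = frechet_derivative (\<lambda>y. frechet_derivative H (at y) w') (at x) w"
proof -
  let ?P = "\<lambda>b. frechet_derivative (\<lambda>y. frechet_derivative H (at y) b) (at x)"
  have f: "H differentiable at y" if "y \<in> U" for y
    using C2 that by (simp add: numeral_2_eq_2)
  have fu: "(\<lambda>y. frechet_derivative H (at y) b) differentiable at x" for b
    using C2 assms(2) by (simp add: numeral_2_eq_2)
  have "((\<lambda>y. \<Sum>b\<in>Basis. frechet_derivative H (at y) b *\<^sub>R b) has_derivative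
      (\<lambda>w. \<Sum>b\<in>Basis. ?P b w *\<^sub>R b)) (at x)"
    using fu by (intro has_derivative_sum has_derivative_scaleR_left) (simp add: frechet_derivative_works)
  then have *: "(grad H has_derivative (\<lambda>w. \<Sum>b\<in>Basis. ?P b w *\<^sub>R b)) (at x)"
    by (rule has_derivative_transform_within_open[OF _ assms(1,2)])
      (simp add: grad_eq_sum_partials(1) f)
  then show "(grad H has_derivative hess H x) (at x)"
    unfolding hess_def using differentiableI frechet_derivative_works by blast
  have "hess H x w = (\<Sum>b\<in>Basis. ?P b w *\<^sub>R b)"
    by (simp add: hess_def frechet_derivative_at[OF *, symmetric])
  then have "hess H x w \<bullet> w' = (\<Sum>b\<in>Basis. ?P b w * (w' \<bullet> b))"
    by (simp add: inner_sum_left inner_commute[of w'])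
  also have "\<dots> = (\<Sum>b\<in>Basis. (w' \<bullet> b) * ?P w b)"
    using symmetric_second_derivative[OF assms] by (intro sum.cong) (auto simp: mult.commute)
  also have "\<dots> = ?P w (\<Sum>b\<in>Basis. (w' \<bullet> b) *\<^sub>R b)"
  proof -
    have l: "linear (?P w)" using fu linear_frechet_derivative by blast
    show ?thesis by (simp add: linear_sum[OF l] linear_cmul[OF l])
  qed
  also have "\<dots> = ?P w' w"
    using symmetric_second_derivative[OF assms] by (simp add: euclidean_representation)
  finally show "hess H x w \<bullet> w' = ?P w' w" .
qed

lemma hess_self_adjoint:
  fixes H :: "'a::euclidean_space \<Rightarrow> real"
  assumes "open U" "x \<in> U" "C_k_on 2 H U"
  shows "hess H x w \<bullet> w' = hess H x w' \<bullet> w"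
  using hess_as_second_derivative(2)[OF assms] symmetric_second_derivative[OF assms]
  by metis

lemma partial_gradient_derivatives:
  fixes H :: "'a::euclidean_space \<times> 'b::euclidean_space \<Rightarrow> real"
  assumes "open U" "x \<in> U" and C2: "C_k_on 2 H U"
  shows "((\<lambda>x. grad_q H (fst x) (snd x)) has_derivative (\<lambda>w. fst (hess H x w))) (at x)"
    and "((\<lambda>x. grad_p H (fst x) (snd x)) has_derivative (\<lambda>w. snd (hess H x w))) (at x)"
proof -
  have f: "H differentiable at y" if "y \<in> U" for y
    using C2 that by (simp add: numeral_2_eq_2)
  note D = hess_as_second_derivative(1)[OF assms]
  show "((\<lambda>x. grad_q H (fst x) (snd x)) has_derivative (\<lambda>w. fst (hess H x w))) (at x)"
    by (rule has_derivative_transform_within_open[OF has_derivative_fst[OF D] assms(1,2)])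
      (simp add: partial_gradients(1) f)
  show "((\<lambda>x. grad_p H (fst x) (snd x)) has_derivative (\<lambda>w. snd (hess H x w))) (at x)"
    by (rule has_derivative_transform_within_open[OF has_derivative_snd[OF D] assms(1,2)])
      (simp add: partial_gradients(2) f)
qed

section \<open>Uniform bounds on a compact convex set\<close>

text \<open>
  Bounds are obtained one partial derivative at a time; this merges them into a single constant.
\<close>
lemma finite_uniform_bound:
  fixes P :: "'i \<Rightarrow> real \<Rightarrow> bool"
  assumes "finite B" and "\<And>b. b \<in> B \<Longrightarrow> \<exists>K. P b K"
    and mono: "\<And>b K K'. P b K \<Longrightarrow> K \<le> K' \<Longrightarrow> P b K'"
  shows "\<exists>K\<ge>0. \<forall>b\<in>B. P b K"
  using assms(1,2)
proof (induction B)
  case empty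
  then show ?case by auto
next
  case (insert c B)
  then obtain K K' where "K \<ge> 0" "\<forall>b\<in>B. P b K" "P c K'" by blast
  then have "0 \<le> max K K'" "\<forall>b\<in>insert c B. P b (max K K')"
    by (auto intro: mono)
  then show ?case by blast
qed

text \<open>
  Continuity on a compact set bounds the function and each partial derivative, hence the operator
  norm of the derivative; convexity turns the latter into a Lipschitz constant.
\<close>
lemma C1_bounded_Lipschitz:
  fixes f :: "'a::euclidean_space \<Rightarrow> real"
  assumes "compact A" "convex A" "A \<subseteq> U" and C1: "C_k_on 1 f U"
  shows "\<exists>K. \<forall>x\<in>A. \<bar>f x\<bar> \<le> K \<and> (\<forall>y\<in>A. \<bar>f x - f y\<bar> \<le> K * norm (x - y))"
proof -
  have f: "f differentiable at x" if "x \<in> A" for x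
    using C1 that assms(3) by auto
  have "continuous_on A f"
    using f by (meson continuous_at_imp_continuous_on differentiable_imp_continuous_within)
  then obtain K0 where K0: "\<And>x. x \<in> A \<Longrightarrow> \<bar>f x\<bar> \<le> K0"
    by (metis continuous_on_compact_bound[OF assms(1)] real_norm_def)
  have "\<exists>K. \<forall>x\<in>A. \<bar>frechet_derivative f (at x) b\<bar> \<le> K" for b
  proof -
    have "continuous_on A (\<lambda>x. frechet_derivative f (at x) b)"
      using C1 by (auto intro: continuous_on_subset[OF _ assms(3)])
    then show ?thesis
      by (metis continuous_on_compact_bound[OF assms(1)] real_norm_def)
  qed
  then have "\<exists>K1\<ge>0. \<forall>b\<in>Basis. \<forall>x\<in>A. \<bar>frechet_derivative f (at x) b\<bar> \<le> K1"
    by (intro finite_uniform_bound) (auto intro: order_trans)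
  then obtain K1 where "K1 \<ge> 0"
    and K1: "\<And>b x. b \<in> Basis \<Longrightarrow> x \<in> A \<Longrightarrow> \<bar>frechet_derivative f (at x) b\<bar> \<le> K1" by blast
  have on: "onorm (frechet_derivative f (at x)) \<le> DIM('a) * K1" if "x \<in> A" for x
  proof (rule onorm_bound)
    fix w
    have l: "linear (frechet_derivative f (at x))" using f that linear_frechet_derivative by blast
    have "frechet_derivative f (at x) w = frechet_derivative f (at x) (\<Sum>b\<in>Basis. (w \<bullet> b) *\<^sub>R b)"
      by (simp add: euclidean_representation)
    also have "\<dots> = (\<Sum>b\<in>Basis. (w \<bullet> b) * frechet_derivative f (at x) b)"
      by (simp add: linear_sum[OF l] linear_cmul[OF l])
    also have "\<bar>\<dots>\<bar> \<le> (\<Sum>b\<in>(Basis::'a set). norm w * K1)"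
    proof (rule order_trans[OF sum_abs sum_mono])
      fix b :: 'a assume "b \<in> Basis"
      then show "\<bar>(w \<bullet> b) * frechet_derivative f (at x) b\<bar> \<le> norm w * K1"
        unfolding abs_mult by (intro mult_mono Basis_le_norm K1 that) auto
    qed
    finally show "norm (frechet_derivative f (at x) w) \<le> DIM('a) * K1 * norm w"
      by (simp add: ac_simps)
  qed (use \<open>K1 \<ge> 0\<close> in simp)
  have L: "\<bar>f x - f y\<bar> \<le> DIM('a) * K1 * norm (x - y)" if "x \<in> A" "y \<in> A" for x y
  proof -
    have "(f has_derivative frechet_derivative f (at x)) (at x within A)" if "x \<in> A" for x
      using f[OF that] by (simp add: frechet_derivative_works has_derivative_at_withinI)
    from differentiable_bound[OF assms(2) this on that] show ?thesis by simp
  qed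
  have "\<bar>f x\<bar> \<le> max K0 (DIM('a) * K1)" if "x \<in> A" for x
    using K0[OF that] by simp
  moreover have "\<bar>f x - f y\<bar> \<le> max K0 (DIM('a) * K1) * norm (x - y)" if "x \<in> A" "y \<in> A" for x y
    by (rule order_trans[OF L[OF that]]) (simp add: mult_right_mono)
  ultimately show ?thesis by blast
qed

lemma norm_le_if_components_le:
  fixes x :: "'a::euclidean_space" and c :: real
  assumes "\<And>b. b \<in> Basis \<Longrightarrow> \<bar>x \<bullet> b\<bar> \<le> c"
  shows "norm x \<le> DIM('a) * c"
  using order_trans[OF norm_le_l1 sum_mono[of Basis, OF assms]] by simp

text \<open>
  The entries of gradient and Hessian are first and second partial derivatives of \<open>H\<close>, and are
  again continuously differentiable, so the scalar result applies to each of them. Summing over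
  the basis yields bounds for the vector and for the operator; the Lipschitz bound of the Hessian
  is where third derivatives of \<open>H\<close> enter.
\<close>
lemma gradient_hessian_bounds:
  fixes H :: "'a::euclidean_space \<Rightarrow> real"
  assumes "compact A" "convex A" "A \<subseteq> U" "open U" and smooth: "smooth_on H U"
  obtains K where "K \<ge> 0"
    and "\<And>x. x \<in> A \<Longrightarrow> norm (grad H x) \<le> K"
    and "\<And>x y. x \<in> A \<Longrightarrow> y \<in> A \<Longrightarrow> norm (grad H x - grad H y) \<le> K * norm (x - y)"
    and "\<And>x w. x \<in> A \<Longrightarrow> norm (hess H x w) \<le> K * norm w"
    and "\<And>x y w. x \<in> A \<Longrightarrow> y \<in> A \<Longrightarrow>
      norm (hess H x w - hess H y w) \<le> K * norm (x - y) * norm w"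
proof -
  define P where "P = (\<lambda>b c x. frechet_derivative (\<lambda>y. frechet_derivative H (at y) b) (at x) c)"
  have C: "C_k_on k H U" for k using smooth by (simp add: smooth_on_def)
  have C1: "C_k_on 1 (\<lambda>y. frechet_derivative H (at y) b) U" for b
    using C[of 2] by (simp add: numeral_2_eq_2)
  have C2: "C_k_on 1 (P b c) U" for b c
    using C[of 3] by (simp add: numeral_3_eq_3 P_def)
  have f: "H differentiable at x" if "x \<in> A" for x
    using C[of 1] assms(3) that by auto
  have comp: "grad H x \<bullet> b = frechet_derivative H (at x) b" if "b \<in> Basis" "x \<in> A" for x b
    using grad_eq_sum_partials(1)[OF f[OF that(2)]] that(1) by simp
  have hP: "hess H x w \<bullet> b = P b w x" if "x \<in> A" for x w b
    unfolding P_def using hess_as_second_derivative(2) assms(3,4) C that by blast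
  have lin: "linear (hess H x)" if "x \<in> A" for x
    using hess_as_second_derivative(1)[OF assms(4) _ C] assms(3) that
      has_derivative_linear by blast
  define BL where "BL = (\<lambda>(g :: 'a \<Rightarrow> real) K. \<forall>x\<in>A. \<bar>g x\<bar> \<le> K \<and>
      (\<forall>y\<in>A. \<bar>g x - g y\<bar> \<le> K * norm (x - y)))"
  have BL_mono: "BL g K'" if "BL g K" "K \<le> K'" for g K K'
    using that mult_right_mono[OF that(2) norm_ge_zero] unfolding BL_def by (meson order_trans)
  have "\<exists>K\<ge>0. \<forall>b\<in>Basis. BL (\<lambda>x. frechet_derivative H (at x) b) K"
  proof (rule finite_uniform_bound)
    show "\<exists>K. BL (\<lambda>x. frechet_derivative H (at x) b) K" for b
      unfolding BL_def by (rule C1_bounded_Lipschitz[OF assms(1-3) C1])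
  qed (auto intro: BL_mono)
  then obtain K1 where "K1 \<ge> 0" and K1:
    "\<And>b x. b \<in> Basis \<Longrightarrow> x \<in> A \<Longrightarrow> \<bar>grad H x \<bullet> b\<bar> \<le> K1"
    "\<And>b x y. b \<in> Basis \<Longrightarrow> x \<in> A \<Longrightarrow> y \<in> A \<Longrightarrow>
       \<bar>grad H x \<bullet> b - grad H y \<bullet> b\<bar> \<le> K1 * norm (x - y)"
    unfolding BL_def by (auto simp: comp)
  have "\<exists>K\<ge>0. \<forall>bc\<in>Basis\<times>Basis. BL (P (fst bc) (snd bc)) K"
  proof (rule finite_uniform_bound)
    show "\<exists>K. BL (P (fst bc) (snd bc)) K" for bc
      unfolding BL_def by (rule C1_bounded_Lipschitz[OF assms(1-3) C2])
  qed (auto intro: BL_mono)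
  then obtain K2 where "K2 \<ge> 0" and K2:
    "\<And>b c x. b \<in> Basis \<Longrightarrow> c \<in> Basis \<Longrightarrow> x \<in> A \<Longrightarrow> \<bar>P b c x\<bar> \<le> K2"
    "\<And>b c x y. b \<in> Basis \<Longrightarrow> c \<in> Basis \<Longrightarrow> x \<in> A \<Longrightarrow> y \<in> A \<Longrightarrow>
       \<bar>P b c x - P b c y\<bar> \<le> K2 * norm (x - y)"
    unfolding BL_def by auto
  have opbound: "norm (T w) \<le> real DIM('a) * real DIM('a) * c * norm w"
    if T: "linear T" and c: "\<And>b d. b \<in> Basis \<Longrightarrow> d \<in> Basis \<Longrightarrow> \<bar>T d \<bullet> b\<bar> \<le> c"
    for T :: "'a \<Rightarrow> 'a" and c w
  proof -
    have "T w = (\<Sum>d\<in>Basis. (w \<bullet> d) *\<^sub>R T d)"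
      using linear_sum[OF T, of "\<lambda>d. (w \<bullet> d) *\<^sub>R d" Basis]
      by (simp add: euclidean_representation linear_cmul[OF T])
    also have "norm \<dots> \<le> (\<Sum>d\<in>(Basis::'a set). norm w * (DIM('a) * c))"
      by (rule sum_norm_le)
        (auto intro!: mult_mono norm_le_if_components_le c simp: Basis_le_norm)
    finally show ?thesis by (simp add: ac_simps)
  qed
  define K where "K = max (DIM('a) * K1) (real DIM('a) * real DIM('a) * K2)"
  have KK: "DIM('a) * K1 \<le> K" "real DIM('a) * real DIM('a) * K2 \<le> K" by (auto simp: K_def)
  show thesis
  proof
    show "K \<ge> 0" using \<open>K1 \<ge> 0\<close> by (simp add: K_def le_max_iff_disj)
    show "norm (grad H x) \<le> K" if "x \<in> A" for x
      using norm_le_if_components_le[OF K1(1)[OF _ that]] KK by linarith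
    show "norm (grad H x - grad H y) \<le> K * norm (x - y)" if "x \<in> A" "y \<in> A" for x y
    proof -
      have "norm (grad H x - grad H y) \<le> DIM('a) * (K1 * norm (x - y))"
        using K1(2)[OF _ that] by (intro norm_le_if_components_le) (simp add: inner_diff_left)
      also have "\<dots> = DIM('a) * K1 * norm (x - y)" by simp
      also have "\<dots> \<le> K * norm (x - y)"
        by (rule mult_right_mono[OF KK(1)]) simp
      finally show ?thesis .
    qed
    show "norm (hess H x w) \<le> K * norm w" if "x \<in> A" for x w
    proof -
      have "norm (hess H x w) \<le> real DIM('a) * real DIM('a) * K2 * norm w"
        by (rule opbound[OF lin[OF that]]) (simp add: hP K2 that)
      also have "\<dots> \<le> K * norm w" by (rule mult_right_mono[OF KK(2)]) simp
      finally show ?thesis .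
    qed
    show "norm (hess H x w - hess H y w) \<le> K * norm (x - y) * norm w"
      if "x \<in> A" "y \<in> A" for x y w
    proof -
      have "norm (hess H x w - hess H y w) \<le> real DIM('a) * real DIM('a) * (K2 * norm (x - y)) * norm w"
        by (rule opbound[OF linear_compose_sub[OF lin[OF that(1)] lin[OF that(2)]]])
          (simp add: inner_diff_left hP K2 that)
      also have "\<dots> = real DIM('a) * real DIM('a) * K2 * (norm (x - y) * norm w)" by simp
      also have "\<dots> \<le> K * (norm (x - y) * norm w)" by (rule mult_right_mono[OF KK(2)]) simp
      finally show ?thesis by simp
    qed
  qed
qed

section \<open>Derivatives of the iterates and of the numerical flow\<close>

text \<open>
  The formal derivative of the \<open>n\<close>-th iterate at \<open>z = (q, p)\<close> in direction \<open>w\<close>, obtained by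
  differentiating the recursion for the iterates: the first component of the Hessian at
  \<open>(q, p\<^sub>n)\<close> is \<open>H\<^sub>q\<^sub>q dq + H\<^sub>q\<^sub>p dp\<^sub>n\<close>.
\<close>
primrec p_iter_deriv ::
  "((real^'n) \<times> (real^'n) \<Rightarrow> real) \<Rightarrow> real \<Rightarrow> (real^'n) \<times> (real^'n) \<Rightarrow> nat
    \<Rightarrow> (real^'n) \<times> (real^'n) \<Rightarrow> real^'n"
where
  "p_iter_deriv H h z 0 w = snd w"
| "p_iter_deriv H h z (Suc n) w = snd w
    - h *\<^sub>R fst (hess H (fst z, p_iter H h (fst z) (snd z) n) (fst w, p_iter_deriv H h z n w))"

lemma has_derivative_p_iter:
  fixes H :: "(real^'n) \<times> (real^'n) \<Rightarrow> real"
  assumes "open U" "C_k_on 2 H U"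
    and "\<And>k. k < n \<Longrightarrow> (fst z, p_iter H h (fst z) (snd z) k) \<in> U"
  shows "((\<lambda>z. p_iter H h (fst z) (snd z) n) has_derivative p_iter_deriv H h z n) (at z)"
  using assms(3)
proof (induction n)
  case 0
  have "p_iter_deriv H h z 0 = snd" by auto
  then show ?case
    using has_derivative_snd[OF has_derivative_ident[of "at z"]] by simp
next
  case (Suc n)
  have D: "((\<lambda>z. (fst z, p_iter H h (fst z) (snd z) n)) has_derivative
      (\<lambda>w. (fst w, p_iter_deriv H h z n w))) (at z)"
    using Suc by (intro has_derivative_Pair has_derivative_fst has_derivative_ident) auto
  have "((\<lambda>z. grad_q H (fst z) (p_iter H h (fst z) (snd z) n)) has_derivative
      (\<lambda>w. fst (hess H (fst z, p_iter H h (fst z) (snd z) n) (fst w, p_iter_deriv H h z n w)))) (at z)"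
    using has_derivative_compose[OF D partial_gradient_derivatives(1)[OF assms(1) _ assms(2)]]
      Suc.prems by simp
  then have "((\<lambda>z. snd z - h *\<^sub>R grad_q H (fst z) (p_iter H h (fst z) (snd z) n)) has_derivative
      (\<lambda>w. snd w - h *\<^sub>R fst (hess H (fst z, p_iter H h (fst z) (snd z) n)
                               (fst w, p_iter_deriv H h z n w)))) (at z)"
    by (intro has_derivative_diff has_derivative_snd has_derivative_ident has_derivative_scaleR_right)
  moreover have "p_iter_deriv H h z (Suc n) = (\<lambda>w. snd w - h *\<^sub>R fst (hess H
      (fst z, p_iter H h (fst z) (snd z) n) (fst w, p_iter_deriv H h z n w)))"
    by auto
  ultimately show ?case by simp
qed

lemma has_derivative_sympl_euler:
  fixes H :: "(real^'n) \<times> (real^'n) \<Rightarrow> real"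
  assumes "open U" "C_k_on 2 H U"
    and in_U: "\<And>k. k \<le> M \<Longrightarrow> (fst z, p_iter H h (fst z) (snd z) k) \<in> U"
  shows "(sympl_euler H M h has_derivative
    (\<lambda>w. (fst w + h *\<^sub>R snd (hess H (fst z, p_iter H h (fst z) (snd z) M) (fst w, p_iter_deriv H h z M w)),
          p_iter_deriv H h z M w))) (at z)"
proof -
  have P: "((\<lambda>z. p_iter H h (fst z) (snd z) M) has_derivative p_iter_deriv H h z M) (at z)"
    using has_derivative_p_iter[OF assms(1,2)] in_U by simp
  have D: "((\<lambda>z. (fst z, p_iter H h (fst z) (snd z) M)) has_derivative
      (\<lambda>w. (fst w, p_iter_deriv H h z M w))) (at z)"
    by (intro has_derivative_Pair has_derivative_fst has_derivative_ident P)
  have "((\<lambda>z. grad_p H (fst z) (p_iter H h (fst z) (snd z) M)) has_derivative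
      (\<lambda>w. snd (hess H (fst z, p_iter H h (fst z) (snd z) M) (fst w, p_iter_deriv H h z M w)))) (at z)"
    using has_derivative_compose[OF D partial_gradient_derivatives(2)[OF assms(1) _ assms(2)]]
      in_U by simp
  then show ?thesis
    unfolding sympl_euler_def Let_def case_prod_unfold
    by (intro has_derivative_Pair has_derivative_add has_derivative_fst has_derivative_ident
        has_derivative_scaleR_right P)
qed

lemma linear_p_iter_deriv:
  fixes H :: "(real^'n) \<times> (real^'n) \<Rightarrow> real"
  assumes "open U" "C_k_on 2 H U"
    and "\<And>k. k < n \<Longrightarrow> (fst z, p_iter H h (fst z) (snd z) k) \<in> U"
  shows "linear (p_iter_deriv H h z n)"
  using has_derivative_linear[OF has_derivative_p_iter[OF assms]] .

section \<open>The pulled-back symplectic form\<close>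

definition sympl_form :: "'a::real_inner \<times> 'a \<Rightarrow> 'a \<times> 'a \<Rightarrow> real"
  where "sympl_form u v = fst u \<bullet> snd v - snd u \<bullet> fst v"

text \<open>
  The map \<open>R\<close> is the derivative of the residual \<open>r = p\<^sub>M - p\<^sub>M\<^sub>+\<^sub>1\<close>, so the right-hand side is the
  pullback of the symplectic form along \<open>(q, p) \<mapsto> (q, p + r)\<close>. With \<open>T\<close> the Hessian at
  \<open>(q, p\<^sub>M)\<close>, and \<open>a\<close>, \<open>b\<close> the derivatives of \<open>p\<^sub>M\<close> along \<open>u\<close>, \<open>v\<close>, both sides expand to
  \<open>u\<^sub>q \<bullet> b - a \<bullet> v\<^sub>q\<close> plus \<open>h\<close> times terms containing \<open>T\<close>, and their difference is
  \<open>h\<close> times \<open>T (u\<^sub>q, a) \<bullet> (v\<^sub>q, b) - T (v\<^sub>q, b) \<bullet> (u\<^sub>q, a)\<close>, which vanishes.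
\<close>
lemma sympl_form_pullback:
  fixes H :: "(real^'n) \<times> (real^'n) \<Rightarrow> real"
  assumes "open U" "C_k_on 2 H U" and in_U: "(fst z, p_iter H h (fst z) (snd z) M) \<in> U"
  defines "\<Phi>' \<equiv> \<lambda>w. (fst w + h *\<^sub>R snd (hess H (fst z, p_iter H h (fst z) (snd z) M) (fst w, p_iter_deriv H h z M w)),
          p_iter_deriv H h z M w)"
    and "R \<equiv> \<lambda>w. p_iter_deriv H h z M w - p_iter_deriv H h z (Suc M) w"
  shows "sympl_form (\<Phi>' u) (\<Phi>' v) = fst u \<bullet> (snd v + R v) - (snd u + R u) \<bullet> fst v"
proof -
  define a where "a = p_iter_deriv H h z M u"
  define b where "b = p_iter_deriv H h z M v"
  define T where "T = hess H (fst z, p_iter H h (fst z) (snd z) M)"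
  have "T (fst u, a) \<bullet> (fst v, b) = T (fst v, b) \<bullet> (fst u, a)"
    unfolding T_def by (rule hess_self_adjoint[OF assms(1) in_U assms(2)])
  then have "h * (fst (T (fst u, a)) \<bullet> fst v + snd (T (fst u, a)) \<bullet> b)
      = h * (fst (T (fst v, b)) \<bullet> fst u + snd (T (fst v, b)) \<bullet> a)"
    by (simp add: inner_prod_def)
  then show ?thesis
    unfolding \<Phi>'_def R_def sympl_form_def
    by (simp add: a_def[symmetric] b_def[symmetric] T_def[symmetric] algebra_simps
        inner_add_left inner_add_right inner_commute)
qed

section \<open>Convergence of the iterates and of their derivatives\<close>

lemma norm_fst_le_norm: "norm (fst w) \<le> norm w"
  and norm_snd_le_norm: "norm (snd w) \<le> norm w"
  by (cases w, simp add: norm_fst_le norm_snd_le)+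

lemma norm_Pair_fst_le: "norm (fst w, a) \<le> norm w + norm a"
  by (rule order_trans[OF norm_Pair_le]) (simp add: norm_fst_le_norm)

text \<open>
  Consecutive differences contract by the factor \<open>h K\<close>, starting from \<open>p\<^sub>1 - p\<^sub>0 = - h H\<^sub>q(q, p)\<close>.
\<close>
lemma norm_p_iter_diff_le:
  fixes H :: "(real^'n) \<times> (real^'n) \<Rightarrow> real"
  assumes "0 \<le> h" "0 \<le> K"
    and H: "\<And>x. x \<in> A \<Longrightarrow> H differentiable at x"
    and B: "\<And>x. x \<in> A \<Longrightarrow> norm (grad H x) \<le> K"
    and L: "\<And>x y. x \<in> A \<Longrightarrow> y \<in> A \<Longrightarrow> norm (grad H x - grad H y) \<le> K * norm (x - y)"
    and "\<And>k. k \<le> n \<Longrightarrow> (q, p_iter H h q p k) \<in> A"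
  shows "norm (p_iter H h q p (Suc n) - p_iter H h q p n) \<le> (h * K) ^ Suc n"
  using assms(6)
proof (induction n)
  case 0
  have "norm (grad_q H q p) \<le> norm (grad H (q, p))"
    using 0[of 0] H by (simp add: partial_gradients norm_fst_le_norm)
  also have "\<dots> \<le> K" using B 0[of 0] by simp
  finally show ?case using \<open>0 \<le> h\<close> by (simp add: mult_left_mono)
next
  case (Suc n)
  let ?x = "(q, p_iter H h q p n)" and ?y = "(q, p_iter H h q p (Suc n))"
  have in_A: "?x \<in> A" "?y \<in> A" using Suc.prems[of n] Suc.prems[of "Suc n"] by auto
  have "norm (p_iter H h q p (Suc (Suc n)) - p_iter H h q p (Suc n))
      = norm (h *\<^sub>R (grad_q H q (p_iter H h q p n) - grad_q H q (p_iter H h q p (Suc n))))"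
    by (simp add: algebra_simps)
  also have "\<dots> = h * norm (fst (grad H ?x - grad H ?y))"
    using in_A H \<open>0 \<le> h\<close> by (simp add: partial_gradients del: p_iter.simps)
  also have "\<dots> \<le> h * (K * norm (?x - ?y))"
    by (intro mult_left_mono order_trans[OF norm_fst_le_norm] L in_A \<open>0 \<le> h\<close>)
  also have "norm (?x - ?y) = norm (p_iter H h q p (Suc n) - p_iter H h q p n)"
    by (simp add: norm_Pair norm_minus_commute)
  also have "h * (K * \<dots>) \<le> h * (K * (h * K) ^ Suc n)"
    using Suc assms(1,2) by (intro mult_left_mono) auto
  finally show ?case by (simp add: mult.assoc)
qed

text \<open>
  With \<open>h K \<le> 1/3\<close> the bound \<open>2\<close> reproduces itself: \<open>1 + h K (1 + 2) \<le> 2\<close>.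
\<close>
lemma norm_p_iter_deriv_le:
  fixes H :: "(real^'n) \<times> (real^'n) \<Rightarrow> real"
  assumes "0 \<le> h" "0 \<le> K" and small: "h * K \<le> 1 / 3"
    and B: "\<And>x w. x \<in> A \<Longrightarrow> norm (hess H x w) \<le> K * norm w"
    and "\<And>k. k < n \<Longrightarrow> (fst z, p_iter H h (fst z) (snd z) k) \<in> A"
  shows "norm (p_iter_deriv H h z n w) \<le> 2 * norm w"
  using assms(5)
proof (induction n)
  case 0
  then show ?case using norm_snd_le_norm[of w] norm_ge_zero[of w] by (simp del: norm_ge_zero)
next
  case (Suc n)
  let ?L = "p_iter_deriv H h z n w" and ?x = "(fst z, p_iter H h (fst z) (snd z) n)"
  have IH: "norm ?L \<le> 2 * norm w" using Suc by simp
  have "norm (p_iter_deriv H h z (Suc n) w) \<le> norm (snd w) + norm (h *\<^sub>R fst (hess H ?x (fst w, ?L)))"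
    unfolding p_iter_deriv.simps by (rule norm_triangle_ineq4)
  also have "\<dots> \<le> norm w + h * (K * (norm w + norm ?L))"
  proof -
    have "norm (fst (hess H ?x (fst w, ?L))) \<le> K * norm (fst w, ?L)"
      using order_trans[OF norm_fst_le_norm B] Suc.prems by simp
    also have "\<dots> \<le> K * (norm w + norm ?L)"
      by (intro mult_left_mono norm_Pair_fst_le assms)
    finally show ?thesis
      using \<open>0 \<le> h\<close> by (simp add: norm_snd_le_norm add_mono mult_left_mono)
  qed
  also have "\<dots> \<le> norm w + h * (K * (3 * norm w))"
    using IH assms(1,2) by (intro add_left_mono mult_left_mono) auto
  also have "\<dots> \<le> 2 * norm w"
    using mult_right_mono[OF small, of "3 * norm w"] by simp
  finally show ?case .
qed

text \<open>
  The difference of two consecutive derivatives comes from two sources: the Hessian is evaluated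
  at different points, which the Lipschitz bound and the distance \<open>(h K)\<^sup>n\<^sup>+\<^sup>1\<close> of the iterates
  control, and it is applied to different vectors, which the induction hypothesis controls. Both
  gain a factor \<open>h K\<close>. The first adds \<open>3\<close> to the numerical factor in every step, because the
  vector in question has norm at most \<open>norm w + 2 * norm w\<close>; this explains the factor \<open>3 (n + 1)\<close>.
\<close>
lemma norm_p_iter_deriv_diff_le:
  fixes H :: "(real^'n) \<times> (real^'n) \<Rightarrow> real"
  assumes "0 \<le> h" "0 \<le> K" and small: "h * K \<le> 1 / 3"
    and "open U" "C_k_on 2 H U" "A \<subseteq> U"
    and B: "\<And>x. x \<in> A \<Longrightarrow> norm (grad H x) \<le> K"
    and L: "\<And>x y. x \<in> A \<Longrightarrow> y \<in> A \<Longrightarrow> norm (grad H x - grad H y) \<le> K * norm (x - y)"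
    and B': "\<And>x w. x \<in> A \<Longrightarrow> norm (hess H x w) \<le> K * norm w"
    and L': "\<And>x y w. x \<in> A \<Longrightarrow> y \<in> A \<Longrightarrow>
      norm (hess H x w - hess H y w) \<le> K * norm (x - y) * norm w"
    and "\<And>k. k \<le> n \<Longrightarrow> (fst z, p_iter H h (fst z) (snd z) k) \<in> A"
  shows "norm (p_iter_deriv H h z (Suc n) w - p_iter_deriv H h z n w)
    \<le> 3 * real (Suc n) * (h * K) ^ Suc n * norm w"
  using assms(11)
proof (induction n)
  case 0
  have "norm (fst (hess H z w)) \<le> K * norm w"
    using order_trans[OF norm_fst_le_norm B'] 0[of 0] by simp
  then have "h * norm (fst (hess H z w)) \<le> h * (K * norm w)"
    using \<open>0 \<le> h\<close> by (rule mult_left_mono)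
  also have "\<dots> \<le> 3 * (h * (K * norm w))" using assms(1,2) by simp
  finally show ?case using \<open>0 \<le> h\<close> by (simp add: mult.assoc)
next
  case (Suc n)
  let ?p = "p_iter H h (fst z) (snd z)" and ?L = "\<lambda>n. p_iter_deriv H h z n w"
  let ?x = "(fst z, ?p n)" and ?y = "(fst z, ?p (Suc n))"
  let ?e = "(h * K) ^ Suc n"
  have in_A: "?x \<in> A" "?y \<in> A" using Suc.prems[of n] Suc.prems[of "Suc n"] by auto
  have "0 \<le> ?e" using assms(1,2) by simp
  have H: "H differentiable at x" if "x \<in> A" for x
    using assms(5,6) that by (auto simp: numeral_2_eq_2)
  have lin: "linear (hess H ?x)"
    using has_derivative_linear[OF hess_as_second_derivative(1)] in_A(1) assms(4,5,6) by blast
  have dx: "norm (?x - ?y) \<le> ?e"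
  proof -
    have "norm (?p (Suc n) - ?p n) \<le> ?e"
      using Suc.prems by (intro norm_p_iter_diff_le[OF assms(1,2) H B L]) auto
    then show ?thesis by (simp add: norm_Pair norm_minus_commute)
  qed
  have dL: "norm (?L (Suc n) - ?L n) \<le> 3 * real (Suc n) * ?e * norm w"
    using Suc by simp
  have "norm (?L (Suc n)) \<le> 2 * norm w"
    using Suc.prems by (intro norm_p_iter_deriv_le[OF assms(1,2) small B']) auto
  then have wL: "norm (fst w, ?L (Suc n)) \<le> 3 * norm w"
    using norm_Pair_fst_le[of w "?L (Suc n)"] by simp
  \<comment> \<open>change of base point at a fixed vector, and change of vector at a fixed base point\<close>
  have split: "hess H ?x (fst w, ?L n) - hess H ?y (fst w, ?L (Suc n))
      = (hess H ?x (fst w, ?L (Suc n)) - hess H ?y (fst w, ?L (Suc n)))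
        - hess H ?x (0, ?L (Suc n) - ?L n)"
    using linear_diff[OF lin, of "(fst w, ?L (Suc n))" "(fst w, ?L n)"] by simp
  have "norm (?L (Suc (Suc n)) - ?L (Suc n))
      = norm (h *\<^sub>R fst (hess H ?x (fst w, ?L n) - hess H ?y (fst w, ?L (Suc n))))"
    by (simp add: algebra_simps)
  also have "\<dots> \<le> h * norm (hess H ?x (fst w, ?L n) - hess H ?y (fst w, ?L (Suc n)))"
    using \<open>0 \<le> h\<close> by (simp only: norm_scaleR abs_of_nonneg) (intro mult_left_mono norm_fst_le_norm)
  also have "\<dots> \<le> h * (K * ?e * (3 * norm w) + K * (3 * real (Suc n) * ?e * norm w))"
  proof (rule mult_left_mono[OF _ \<open>0 \<le> h\<close>])
    have "norm (hess H ?x (fst w, ?L (Suc n)) - hess H ?y (fst w, ?L (Suc n))) \<le> K * ?e * (3 * norm w)"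
      using \<open>0 \<le> K\<close> \<open>0 \<le> ?e\<close>
      by (intro order_trans[OF L'[OF in_A]] mult_mono mult_left_mono dx wL) auto
    moreover have "norm (hess H ?x (0, ?L (Suc n) - ?L n)) \<le> K * (3 * real (Suc n) * ?e * norm w)"
    proof (rule order_trans[OF B'[OF in_A(1)]])
      show "K * norm (0 :: real^'n, ?L (Suc n) - ?L n) \<le> K * (3 * real (Suc n) * ?e * norm w)"
        using mult_left_mono[OF dL \<open>0 \<le> K\<close>] by (simp only: norm_Pair norm_zero) simp
    qed
    ultimately show "norm (hess H ?x (fst w, ?L n) - hess H ?y (fst w, ?L (Suc n)))
        \<le> K * ?e * (3 * norm w) + K * (3 * real (Suc n) * ?e * norm w)"
      unfolding split by (intro order_trans[OF norm_triangle_ineq4 add_mono])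
  qed
  also have "\<dots> = 3 * real (Suc (Suc n)) * (h * K) ^ Suc (Suc n) * norm w"
    by (simp add: algebra_simps)
  finally show ?case .
qed

section \<open>Stacked coordinates and block matrices\<close>

lemma stack_unstack [simp]: "stack (unstack x) = x"
  by (simp add: stack_def unstack_def vec_eq_iff split: sum.split)

lemma unstack_stack [simp]: "unstack (stack z) = z"
  by (simp add: stack_def unstack_def vec_eq_iff prod_eq_iff)

lemma sum_UNIV_sum: "(\<Sum>i\<in>UNIV. f i) = (\<Sum>a\<in>UNIV. f (Inl a)) + (\<Sum>b\<in>UNIV. f (Inr b))"
  for f :: "'a::finite + 'b::finite \<Rightarrow> 'c::comm_monoid_add"
  by (simp add: UNIV_Plus_UNIV[symmetric] sum.Plus del: UNIV_Plus_UNIV)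

lemma inner_stack: "stack z \<bullet> stack w = z \<bullet> w"
  by (simp add: inner_vec_def inner_prod_def sum_UNIV_sum stack_def)

lemma block_matrix_mult_stack:
  "block_matrix A B C D *v stack z =
    stack (A *v fst z + B *v snd z, C *v fst z + D *v snd z)"
  by (simp add: vec_eq_iff matrix_vector_mult_def block_matrix_def stack_def sum_UNIV_sum
      split: sum.split)

lemma linear_stack: "linear stack" and linear_unstack: "linear unstack"
  by (auto intro!: linearI simp: stack_def unstack_def vec_eq_iff split: sum.split)

lemma has_derivative_stacked:
  assumes "(f has_derivative f') (at z)"
  shows "(stacked f has_derivative stacked f') (at (stack z))"
proof -
  have s: "(stack has_derivative stack) (at x within S)"
    and u: "(unstack has_derivative unstack) (at y within T)" for x S y T
    using linear_stack linear_unstack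
    by (auto intro!: bounded_linear_imp_has_derivative simp: linear_conv_bounded_linear)
  have "((\<lambda>x. f (unstack x)) has_derivative (\<lambda>v. f' (unstack v))) (at (stack z))"
    using has_derivative_compose[OF u, of f f' "stack z"] assms by simp
  from has_derivative_compose[OF this s] show ?thesis
    by (simp add: stacked_def o_def)
qed

lemma jacobian_stacked:
  assumes "(f has_derivative f') (at z)"
  shows "stacked f differentiable (at (stack z))"
    and "jacobian (stacked f) (at (stack z)) *v stack w = stack (f' w)"
proof -
  note D = has_derivative_stacked[OF assms]
  then show d: "stacked f differentiable (at (stack z))" by (rule differentiableI)
  have "(*v) (jacobian (stacked f) (at (stack z))) = stacked f'"
    using has_derivative_unique[OF d[unfolded jacobian_works] D] .
  then show "jacobian (stacked f) (at (stack z)) *v stack w = stack (f' w)"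
    by (simp add: stacked_def)
qed

lemma inner_sympl_J:
  fixes u v :: "(real^'n) \<times> (real^'n)"
  shows "stack u \<bullet> (sympl_J *v stack v) = sympl_form u v"
proof -
  have "- mat 1 *v x = - x" for x :: "real^'n"
    using matrix_vector_mult_diff_rdistrib[of 0 "mat 1" x] by simp
  then show ?thesis
    by (simp add: sympl_J_def block_matrix_mult_stack inner_stack inner_prod_def sympl_form_def)
qed

text \<open>
  Reduces matrix identities in stacked coordinates to identities of bilinear forms on pairs, so
  that block products never have to be expanded.
\<close>
lemma matrix_eqI_stack:
  assumes "\<And>u v. stack u \<bullet> (A *v stack v) = stack u \<bullet> (B *v stack v)"
  shows "A = B"
proof -
  have "x \<bullet> (A *v y - B *v y) = 0" for x y
    using assms[of "unstack x" "unstack y"] by (simp add: inner_diff_right)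
  then have "A *v y = B *v y" for y
    by (metis inner_eq_zero_iff right_minus_eq)
  then show ?thesis by (simp add: matrix_eq)
qed

lemma inner_congruence:
  fixes A B :: "real^'n^'n"
  shows "x \<bullet> ((transpose A ** B ** A) *v y) = (A *v x) \<bullet> (B *v (A *v y))"
  by (metis dot_lmul_matrix matrix_vector_mul_assoc vector_transpose_matrix transpose_transpose)

text \<open>
  The bilinear form \<open>u\<^sub>q \<bullet> (v\<^sub>p + R v) - (u\<^sub>p + R u) \<bullet> v\<^sub>q\<close> contains no product of a \<open>p\<close>-component
  of \<open>u\<close> with a \<open>p\<close>-component of \<open>v\<close>, whence the zero block. Splitting
  \<open>R v = R\<^sub>q v\<^sub>q + R\<^sub>p v\<^sub>p\<close> identifies the other blocks.
\<close>
lemma congruence_eq_block_matrix: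
  fixes A :: "real^('n::finite + 'n)^('n + 'n)" and \<Phi>' :: "(real^'n) \<times> (real^'n) \<Rightarrow> (real^'n) \<times> (real^'n)"
    and R :: "(real^'n) \<times> (real^'n) \<Rightarrow> real^'n"
  assumes A: "\<And>w. A *v stack w = stack (\<Phi>' w)"
    and R: "linear R"
    and form: "\<And>u v. sympl_form (\<Phi>' u) (\<Phi>' v) = fst u \<bullet> (snd v + R v) - (snd u + R u) \<bullet> fst v"
  defines "Rq \<equiv> matrix (\<lambda>a. R (a, 0))" and "Rp \<equiv> matrix (\<lambda>b. R (0, b))"
  shows "transpose A ** sympl_J ** A
    = block_matrix (Rq - transpose Rq) (mat 1 + Rp) (- transpose (mat 1 + Rp)) 0"
proof (rule matrix_eqI_stack)
  fix u v :: "(real^'n) \<times> (real^'n)"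
  have "linear (\<lambda>a::real^'n. (a, 0::real^'n))" "linear (\<lambda>b::real^'n. (0::real^'n, b))"
    by (simp_all add: linear_iff)
  then have "linear (\<lambda>a. R (a, 0))" "linear (\<lambda>b. R (0, b))"
    using linear_compose[OF _ R] by (auto simp: o_def)
  then have R_eq: "R w = Rq *v fst w + Rp *v snd w" for w
    using linear_add[OF R, of "(fst w, 0)" "(0, snd w)"]
    by (simp add: Rq_def Rp_def matrix_works)
  have tr: "x \<bullet> (y v* B) = y \<bullet> (B *v x)" for x y :: "real^'n" and B
    by (metis dot_lmul_matrix inner_commute)
  have neg: "(- B) *v x = - (B *v x)" for B :: "real^'n^'n" and x
    using matrix_vector_mult_diff_rdistrib[of 0 B x] by simp
  have tr_add: "transpose (mat 1 + Rp) = mat 1 + transpose Rp"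
    by (simp add: transpose_def vec_eq_iff mat_def)
  have "stack u \<bullet> ((transpose A ** sympl_J ** A) *v stack v) = sympl_form (\<Phi>' u) (\<Phi>' v)"
    by (simp add: inner_congruence A inner_sympl_J)
  also have "\<dots> = stack u \<bullet> (block_matrix (Rq - transpose Rq) (mat 1 + Rp) (- transpose (mat 1 + Rp)) 0 *v stack v)"
    unfolding form R_eq tr_add
    by (simp add: block_matrix_mult_stack inner_stack inner_prod_def neg tr dot_lmul_matrix inner_add_left
        inner_add_right inner_diff_right matrix_vector_mult_add_rdistrib
        matrix_vector_mult_diff_rdistrib inner_commute algebra_simps)
  finally show "stack u \<bullet> ((transpose A ** sympl_J ** A) *v stack v)
    = stack u \<bullet> (block_matrix (Rq - transpose Rq) (mat 1 + Rp) (- transpose (mat 1 + Rp)) 0 *v stack v)" .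
qed

lemma block_matrix_eq_sympl_J_plus:
  "block_matrix D (mat 1 + E) (- transpose (mat 1 + E)) 0
    = sympl_J + block_matrix D E (- transpose E) 0"
  by (auto simp: block_matrix_def sympl_J_def vec_eq_iff transpose_def mat_def split: sum.split)

lemma norm_matrix_le_if_entries_le:
  fixes A :: "real^'n^'m"
  assumes "\<And>i j. \<bar>A $ i $ j\<bar> \<le> c"
  shows "norm A \<le> real CARD('m) * real CARD('n) * c"
proof -
  have "norm A \<le> (\<Sum>i\<in>UNIV. norm (A $ i))"
    unfolding norm_vec_def[of A] by (rule L2_set_le_sum) simp
  also have "\<dots> \<le> (\<Sum>i\<in>(UNIV::'m set). \<Sum>j\<in>(UNIV::'n set). c)"
    by (intro sum_mono order_trans[OF norm_le_l1_cart] assms)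
  finally show ?thesis by simp
qed

lemma matrix_entry_le_if_norm_le:
  fixes f :: "real^'n \<Rightarrow> real^'m"
  assumes "\<And>x. norm (f x) \<le> c * norm x"
  shows "\<bar>matrix f $ i $ j\<bar> \<le> c"
proof -
  have "\<bar>matrix f $ i $ j\<bar> \<le> norm (f (axis j 1))"
    by (simp add: matrix_def component_le_norm_cart)
  also have "\<dots> \<le> c" using assms[of "axis j 1"] by (simp add: norm_axis_1)
  finally show ?thesis .
qed

section \<open>Order of the symplecticity defect\<close>

theorem corollary3:
  fixes H :: "(real^'n) \<times> (real^'n) \<Rightarrow> real"
    and \<D> :: "((real^'n) \<times> (real^'n)) set"
    and M :: nat
  assumes "compact \<D>" and "convex \<D>"
    and "\<exists>U. open U \<and> \<D> \<subseteq> U \<and> smooth_on H U"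
    and "M \<ge> 1"
  shows "\<exists>C. \<forall>S h0. admissible H \<D> M S h0 \<longrightarrow>
    (\<exists>D E.
       (\<forall>h z. 0 < h \<and> h \<le> h0 \<and> z \<in> S \<longrightarrow>
          stacked (sympl_euler H M h) differentiable at (stack z) \<and>
          (let D\<Phi> = jacobian (stacked (sympl_euler H M h)) (at (stack z)) in
             transpose D\<Phi> ** sympl_J ** D\<Phi>
               = block_matrix (D h z) (mat 1 + E h z) (- transpose (mat 1 + E h z)) 0 \<and>
             transpose D\<Phi> ** sympl_J ** D\<Phi>
               = sympl_J + block_matrix (D h z) (E h z) (- transpose (E h z)) 0)) \<and>
       order_with_const C (M + 1) h0 S D \<and>
       order_with_const C (M + 1) h0 S E)"
proof -
  obtain U where U: "open U" "\<D> \<subseteq> U" "smooth_on H U" using assms(3) by blast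
  have C2: "C_k_on 2 H U" using U(3) by (simp add: smooth_on_def)
  obtain K where K: "K \<ge> 0"
    "\<And>x. x \<in> \<D> \<Longrightarrow> norm (grad H x) \<le> K"
    "\<And>x y. x \<in> \<D> \<Longrightarrow> y \<in> \<D> \<Longrightarrow> norm (grad H x - grad H y) \<le> K * norm (x - y)"
    "\<And>x w. x \<in> \<D> \<Longrightarrow> norm (hess H x w) \<le> K * norm w"
    "\<And>x y w. x \<in> \<D> \<Longrightarrow> y \<in> \<D> \<Longrightarrow>
      norm (hess H x w - hess H y w) \<le> K * norm (x - y) * norm w"
    using gradient_hessian_bounds[OF assms(1,2) U(2,1,3)] by metis
  define R where "R = (\<lambda>h z w. p_iter_deriv H h z M w - p_iter_deriv H h z (Suc M) w)"
  define Rq where "Rq = (\<lambda>h z. matrix (\<lambda>a. R h z (a, 0)))"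
  define E where "E = (\<lambda>h z. matrix (\<lambda>b. R h z (0, b)))"
  define D where "D = (\<lambda>h z. Rq h z - transpose (Rq h z))"
  define c where "c = 3 * real (Suc M) * K ^ Suc M"
  \<comment> \<open>the factor 2 accounts for \<open>D\<close> being a difference of two matrices bounded like \<open>E\<close>\<close>
  define C where "C = real CARD('n) * real CARD('n) * (2 * c)"
  have "c \<ge> 0" using K(1) by (simp add: c_def)
  have main: "\<exists>D E.
       (\<forall>h z. 0 < h \<and> h \<le> h0 \<and> z \<in> S \<longrightarrow>
          stacked (sympl_euler H M h) differentiable at (stack z) \<and>
          (let D\<Phi> = jacobian (stacked (sympl_euler H M h)) (at (stack z)) in
             transpose D\<Phi> ** sympl_J ** D\<Phi>
               = block_matrix (D h z) (mat 1 + E h z) (- transpose (mat 1 + E h z)) 0 \<and>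
             transpose D\<Phi> ** sympl_J ** D\<Phi>
               = sympl_J + block_matrix (D h z) (E h z) (- transpose (E h z)) 0)) \<and>
       order_with_const C (M + 1) h0 S D \<and>
       order_with_const C (M + 1) h0 S E"
    if adm: "admissible H \<D> M S h0" for S h0
  proof (intro exI conjI allI impI)
    have in_D: "(fst z, p_iter H h (fst z) (snd z) k) \<in> \<D>"
      if "0 < h" "h \<le> h0" "z \<in> S" "k \<le> M" for h z k
      using adm that unfolding admissible_def by (metis prod.collapse)
    show "stacked (sympl_euler H M h) differentiable at (stack z)"
      and "let D\<Phi> = jacobian (stacked (sympl_euler H M h)) (at (stack z)) in
             transpose D\<Phi> ** sympl_J ** D\<Phi>
               = block_matrix (D h z) (mat 1 + E h z) (- transpose (mat 1 + E h z)) 0 \<and>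
             transpose D\<Phi> ** sympl_J ** D\<Phi>
               = sympl_J + block_matrix (D h z) (E h z) (- transpose (E h z)) 0"
      if hz: "0 < h \<and> h \<le> h0 \<and> z \<in> S" for h z
    proof -
      have in_U: "(fst z, p_iter H h (fst z) (snd z) k) \<in> U" if "k \<le> M" for k
        using in_D[of h z k] hz that U(2) by blast
      have "linear (p_iter_deriv H h z M)" "linear (p_iter_deriv H h z (Suc M))"
        by (rule linear_p_iter_deriv[OF U(1) C2]; simp add: in_U)+
      then have lin: "linear (R h z)" unfolding R_def by (rule linear_compose_sub)
      note D\<Phi> = has_derivative_sympl_euler[OF U(1) C2 in_U]
      show "stacked (sympl_euler H M h) differentiable at (stack z)"
        using jacobian_stacked(1)[OF D\<Phi>] by simp
      have "transpose D\<Phi> ** sympl_J ** D\<Phi>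
          = block_matrix (D h z) (mat 1 + E h z) (- transpose (mat 1 + E h z)) 0"
        if "D\<Phi> = jacobian (stacked (sympl_euler H M h)) (at (stack z))" for D\<Phi>
        unfolding D_def Rq_def E_def that
      proof (rule congruence_eq_block_matrix[OF jacobian_stacked(2)[OF D\<Phi>] lin])
        show "sympl_form
           (fst u + h *\<^sub>R snd (hess H (fst z, p_iter H h (fst z) (snd z) M) (fst u, p_iter_deriv H h z M u)),
            p_iter_deriv H h z M u)
           (fst v + h *\<^sub>R snd (hess H (fst z, p_iter H h (fst z) (snd z) M) (fst v, p_iter_deriv H h z M v)),
            p_iter_deriv H h z M v)
          = fst u \<bullet> (snd v + R h z v) - (snd u + R h z u) \<bullet> fst v" for u v
          unfolding R_def by (rule sympl_form_pullback[OF U(1) C2 in_U]) simp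
      qed simp
      then show "let D\<Phi> = jacobian (stacked (sympl_euler H M h)) (at (stack z)) in
             transpose D\<Phi> ** sympl_J ** D\<Phi>
               = block_matrix (D h z) (mat 1 + E h z) (- transpose (mat 1 + E h z)) 0 \<and>
             transpose D\<Phi> ** sympl_J ** D\<Phi>
               = sympl_J + block_matrix (D h z) (E h z) (- transpose (E h z)) 0"
        by (simp add: Let_def block_matrix_eq_sympl_J_plus)
    qed
    have bound: "norm (D h z) \<le> C * h ^ (M + 1) \<and> norm (E h z) \<le> C * h ^ (M + 1)"
      if h: "0 < h" "h \<le> h0" "h * K \<le> 1 / 3" and z: "z \<in> S" for h z
    proof -
      have R: "norm (R h z w) \<le> c * h ^ Suc M * norm w" for w
      proof -
        have "norm (R h z w) = norm (p_iter_deriv H h z (Suc M) w - p_iter_deriv H h z M w)"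
          unfolding R_def by (rule norm_minus_commute)
        also have "\<dots> \<le> 3 * real (Suc M) * (h * K) ^ Suc M * norm w"
          using h z in_D
          by (intro norm_p_iter_deriv_diff_le[OF _ K(1) h(3) U(1) C2 U(2) K(2-5)]) auto
        also have "\<dots> = c * h ^ Suc M * norm w"
          unfolding c_def power_mult_distrib by (simp only: mult_ac)
        finally show ?thesis .
      qed
      have "norm (R h z (a, 0)) \<le> c * h ^ Suc M * norm a"
        and "norm (R h z (0, a)) \<le> c * h ^ Suc M * norm a" for a
        using R[of "(a, 0)"] R[of "(0, a)"] by (simp_all add: norm_Pair)
      then have Rq: "\<bar>Rq h z $ i $ j\<bar> \<le> c * h ^ Suc M" and E: "\<bar>E h z $ i $ j\<bar> \<le> c * h ^ Suc M" for i j
        unfolding Rq_def E_def by (intro matrix_entry_le_if_norm_le; blast)+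
      have "\<bar>D h z $ i $ j\<bar> \<le> 2 * c * h ^ Suc M" for i j
        using Rq[of i j] Rq[of j i] unfolding D_def
        by (simp only: transpose_def vector_minus_component vec_lambda_beta)
      moreover have "0 \<le> c * h ^ Suc M" using \<open>c \<ge> 0\<close> h(1) by simp
      then have "\<bar>E h z $ i $ j\<bar> \<le> 2 * c * h ^ Suc M" for i j
        using E[of i j] by simp
      ultimately show ?thesis
        using norm_matrix_le_if_entries_le[of "D h z" "2 * c * h ^ Suc M"]
          norm_matrix_le_if_entries_le[of "E h z" "2 * c * h ^ Suc M"]
        by (simp add: C_def mult.assoc)
    qed
    \<comment> \<open>\<open>K + 1\<close> avoids a division by zero when \<open>K = 0\<close>\<close>
    have "\<forall>\<^sub>F h in at_right 0. h \<in> {0<..<1 / (3 * (K + 1))}"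
      using K(1) by (intro eventually_at_right_real) simp
    then have small: "\<forall>\<^sub>F h in at_right 0. 0 < h \<and> h * K \<le> 1 / 3"
    proof (rule eventually_mono)
      fix h :: real assume h: "h \<in> {0<..<1 / (3 * (K + 1))}"
      then have "h * (K + 1) \<le> 1 / 3" using K(1) by (simp add: field_simps)
      moreover have "h * K \<le> h * (K + 1)" using h by simp
      ultimately have "h * K \<le> 1 / 3" by linarith
      then show "0 < h \<and> h * K \<le> 1 / 3" using h by simp
    qed
    show "order_with_const C (M + 1) h0 S D" "order_with_const C (M + 1) h0 S E"
      unfolding order_with_const_def
      using bound by (auto intro!: eventually_mono[OF small])
  qed
  then show ?thesis by blast
qed

end
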